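(* Let $H$ be a Hilbert left $\mathbb{O}$-module and let $S=\{x_\alpha\}_{\alpha\in\Lambda}$ be a weak associative orthonormal basis of $H$. Then any $x\in H$ can be uniquely expressed as $$x=\sum_{\alpha\in\Lambda}\langle x,x_\alpha\rangle x_\alpha,$$ and $$\|x\|^2=\sum_{\alpha\in\Lambda}|\langle x,x_\alpha\rangle|^2.$$
   Context: $\mathbb{O}$ is the real algebra of octonions, with conjugation $x\mapsto\overline{x}$ and real part $\operatorname{Re}x=\tfrac12(x+\overline{x})$. A left $\mathbb{O}$-module is a real vector space $M$ with an $\mathbb{R}$-linear map $L:\mathbb{O}\to\operatorname{End}_{\mathbb{R}}(M)$, written $px:=L_p(x)$, such that $1x=x$ and $[p,q,x]=-[q,p,x]$ for all $p,q\in\mathbb{O}$, $x\in M$, where $[p,q,x]:=(pq)x-p(qx)$ (equivalently $p(px)=p^2x$ for all $p,x$). A Hilbert left $\mathbb{O}$-module (or $\mathbb{O}$-Hilbert space) is a left $\mathbb{O}$-module $H$ with an $\mathbb{R}$-bilinear map $\langle\cdot,\cdot\rangle:H\times H\to\mathbb{O}$ such that for all $u,v\in H$, $p\in\mathbb{O}$: (1) $\operatorname{Re}(\langle pu,v\rangle-p\langle u,v\rangle)=0$; (2) $\langle u,v\rangle=\overline{\langle v,u\rangle}$; (3) $\langle u,u\rangle\in[0,\infty)$, and $\langle u,u\rangle=0$ iff $u=0$; and $H$ is complete for the norm $\|u\|=\sqrt{\langle u,u\rangle}$. The second associator is $[p,u,v]:=\langle pu,v\rangle-p\langle u,v\rangle$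 for $p\in\mathbb{O}$, $u,v\in H$. A subset $S=\{x_\alpha\}_{\alpha\in\Lambda}\subseteq H$ is an orthonormal system if $\langle x_\alpha,x_\beta\rangle=\delta_{\alpha\beta}$ for all $\alpha,\beta\in\Lambda$; it is an orthonormal basis if it is an orthonormal system not properly contained in any other orthonormal system. An orthonormal basis $S$ is weak associative if $[p,x_\alpha,x_\beta]=0$ for all $p\in\mathbb{O}$ and all $\alpha,\beta\in\Lambda$. The sums over $\Lambda$ are norm-convergent sums with at most countably many nonzero terms. "Uniquely expressed" means: if $x=\sum_{\alpha\in\Lambda}p_\alpha x_\alpha$ is such a sum with $p_\alpha\in\mathbb{O}$, then $p_\alpha=\langle x,x_\alpha\rangle$ for all $\alpha$. *)

theory Defs
  imports "HOL-Analysis.Analysis"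
begin

section \<open>Octonions\<close>

text \<open>
  The octonions are obtained by applying the Cayley--Dickson doubling twice to the complex numbers.
  At each step \<open>(a, b)\<^sup>* = (a\<^sup>*, -b)\<close> and
  \<open>(a, b) (c, d) = (a c - d\<^sup>* b, d a + b c\<^sup>*)\<close>; the order of the factors matters in the
  second doubling.
\<close>

type_synonym quat = "complex \<times> complex"

definition quat_cnj :: "quat \<Rightarrow> quat" where
  "quat_cnj p = (cnj (fst p), - snd p)"

definition quat_mult :: "quat \<Rightarrow> quat \<Rightarrow> quat" where
  "quat_mult p q =
     (fst p * fst q - cnj (snd q) * snd p, snd q * fst p + snd p * cnj (fst q))"

typedef octonion = "UNIV :: (quat \<times> quat) set"
  morphisms quat_pair Octonion by simp

setup_lifting type_definition_octonion

lift_definition oct_cnj :: "octonion \<Rightarrow> octonion" is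
  "\<lambda>p. (quat_cnj (fst p), - snd p)" .

lift_definition oct_Re :: "octonion \<Rightarrow> real" is
  "\<lambda>p. Re (fst (fst p))" .

instantiation octonion :: "{real_vector, times, one}"
begin

lift_definition zero_octonion :: octonion is 0 .
lift_definition plus_octonion :: "octonion \<Rightarrow> octonion \<Rightarrow> octonion" is "(+)" .
lift_definition minus_octonion :: "octonion \<Rightarrow> octonion \<Rightarrow> octonion" is "(-)" .
lift_definition uminus_octonion :: "octonion \<Rightarrow> octonion" is uminus .
lift_definition scaleR_octonion :: "real \<Rightarrow> octonion \<Rightarrow> octonion" is scaleR .
lift_definition one_octonion :: octonion is "((1, 0), 0)" .
lift_definition times_octonion :: "octonion \<Rightarrow> octonion \<Rightarrow> octonion" is
  "\<lambda>p q. (quat_mult (fst p) (fst q) - quat_mult (quat_cnj (snd q)) (snd p),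
          quat_mult (snd q) (fst p) + quat_mult (snd p) (quat_cnj (fst q)))" .

instance
  by standard (transfer; simp add: algebra_simps)+

end

text \<open>The modulus of an octonion is the Euclidean norm of its eight real coordinates.\<close>

instantiation octonion :: real_inner
begin

lift_definition inner_octonion :: "octonion \<Rightarrow> octonion \<Rightarrow> real" is inner .
definition norm_octonion :: "octonion \<Rightarrow> real" where
  "norm_octonion p = sqrt (inner p p)"
definition sgn_octonion :: "octonion \<Rightarrow> octonion" where
  "sgn_octonion p = p /\<^sub>R norm p"
definition dist_octonion :: "octonion \<Rightarrow> octonion \<Rightarrow> real" where
  "dist_octonion p q = norm (p - q)"
definition uniformity_octonion :: "(octonion \<times> octonion) filter" where
  "uniformity_octonion = (INF e\<in>{0<..}. principal {(p, q). dist p q < e})"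
definition open_octonion :: "octonion set \<Rightarrow> bool" where
  "open_octonion U \<longleftrightarrow> (\<forall>p\<in>U. eventually (\<lambda>(p', q). p' = p \<longrightarrow> q \<in> U) uniformity)"

instance
proof
  fix p q r :: octonion and a :: real
  show "inner p q = inner q p" by transfer (simp add: inner_commute)
  show "inner (p + q) r = inner p r + inner q r" by transfer (simp add: inner_add_left)
  show "inner (a *\<^sub>R p) q = a * inner p q" by transfer simp
  show "0 \<le> inner p p" by transfer simp
  show "inner p p = 0 \<longleftrightarrow> p = 0" by transfer simp
qed (simp_all only: norm_octonion_def sgn_octonion_def dist_octonion_def
       uniformity_octonion_def open_octonion_def)

end

lemma oct_Re_eq: "oct_Re p *\<^sub>R 1 = (1/2) *\<^sub>R (p + oct_cnj p)"
  by transfer (simp add: quat_cnj_def prod_eq_iff complex_eq_iff)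

lemma oct_mult_cnj: "p * oct_cnj p = (norm p)\<^sup>2 *\<^sub>R 1"
  unfolding power2_norm_eq_inner
  by transfer (simp add: quat_cnj_def quat_mult_def prod_eq_iff complex_eq_iff
      inner_prod_def inner_complex_def algebra_simps power2_eq_square)

lemma oct_left_alternative: "p * (p * q) = (p * p) * (q::octonion)"
  by transfer (simp add: quat_cnj_def quat_mult_def prod_eq_iff complex_eq_iff algebra_simps)

lemma oct_right_alternative: "(q * p) * p = q * (p * (p::octonion))"
  by transfer (simp add: quat_cnj_def quat_mult_def prod_eq_iff complex_eq_iff algebra_simps)


section \<open>Hilbert left modules over the octonions\<close>

locale octonion_left_module =
  fixes act :: "octonion \<Rightarrow> 'a::real_vector \<Rightarrow> 'a"
  assumes bilinear_act: "bilinear act"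
    and act_one: "act 1 x = x"
    and associator_alternating:
      "act (p * q) x - act p (act q x) = - (act (q * p) x - act q (act p x))"

text \<open>
  The norm of the type class is required to be the one induced by the octonion-valued inner
  product (\<open>norm_eq\<close>), so that completeness for that norm is the sort constraint \<open>banach\<close>. The
  interval \<open>[0, \<infinity>)\<close> is embedded in the octonions as the non-negative multiples of \<open>1\<close>.
\<close>

locale octonion_hilbert_module = octonion_left_module act
  for act :: "octonion \<Rightarrow> 'a::banach \<Rightarrow> 'a" +
  fixes ip :: "'a \<Rightarrow> 'a \<Rightarrow> octonion"
  assumes bilinear_ip: "bilinear ip"
    and Re_ip_act: "oct_Re (ip (act p u) v - p * ip u v) = 0"
    and ip_cnj: "ip u v = oct_cnj (ip v u)"
    and ip_self_nonneg: "\<exists>r\<ge>0. ip u u = r *\<^sub>R 1"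
    and ip_self_eq_0_iff: "ip u u = 0 \<longleftrightarrow> u = 0"
    and norm_eq: "norm u = sqrt (oct_Re (ip u u))"

definition second_associator ::
    "(octonion \<Rightarrow> 'a \<Rightarrow> 'a) \<Rightarrow> ('a \<Rightarrow> 'a \<Rightarrow> octonion) \<Rightarrow> octonion \<Rightarrow> 'a \<Rightarrow> 'a \<Rightarrow> octonion" where
  "second_associator act ip p u v = ip (act p u) v - p * ip u v"

text \<open>
  Systems are families \<open>e\<close> indexed by a set \<open>I\<close>; a set \<open>T\<close> of vectors is regarded as the family
  \<open>\<lambda>t. t\<close> indexed by \<open>T\<close>. Orthonormality forces a family to be injective.
\<close>

definition orthonormal_system ::
    "('a \<Rightarrow> 'a \<Rightarrow> octonion) \<Rightarrow> ('i \<Rightarrow> 'a) \<Rightarrow> 'i set \<Rightarrow> bool" where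
  "orthonormal_system ip e I \<longleftrightarrow>
     (\<forall>i\<in>I. \<forall>j\<in>I. ip (e i) (e j) = (if i = j then 1 else 0))"

definition orthonormal_basis ::
    "('a \<Rightarrow> 'a \<Rightarrow> octonion) \<Rightarrow> ('i \<Rightarrow> 'a) \<Rightarrow> 'i set \<Rightarrow> bool" where
  "orthonormal_basis ip e I \<longleftrightarrow>
     orthonormal_system ip e I \<and>
     \<not> (\<exists>T. orthonormal_system ip (\<lambda>t. t) T \<and> e ` I \<subset> T)"

definition weak_associative_basis ::
    "(octonion \<Rightarrow> 'a \<Rightarrow> 'a) \<Rightarrow> ('a \<Rightarrow> 'a \<Rightarrow> octonion) \<Rightarrow> ('i \<Rightarrow> 'a) \<Rightarrow> 'i set \<Rightarrow> bool" where
  "weak_associative_basis act ip e I \<longleftrightarrow>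
     orthonormal_basis ip e I \<and>
     (\<forall>p. \<forall>i\<in>I. \<forall>j\<in>I. second_associator act ip p (e i) (e j) = 0)"

definition has_countable_sum ::
    "('i \<Rightarrow> 'b::real_normed_vector) \<Rightarrow> 'b \<Rightarrow> 'i set \<Rightarrow> bool" where
  "has_countable_sum f s I \<longleftrightarrow> countable {i\<in>I. f i \<noteq> 0} \<and> (f has_sum s) I"

end

theory Submission
  imports Defs
begin

text \<open>
  Weak associativity gives \<open>\<langle>p x\<^sub>\<alpha>, x\<^sub>\<beta>\<rangle> = p \<delta>\<^sub>\<alpha>\<^sub>\<beta>\<close>, so finite combinations
  \<open>\<Sum> p\<^sub>\<alpha> x\<^sub>\<alpha>\<close> satisfy Pythagoras and Bessel exactly as over the reals, although \<open>\<langle>\<cdot>, v\<rangle>\<close> is not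
  octonion-linear in general. Bessel and completeness make \<open>\<Sum> \<langle>x, x\<^sub>\<alpha>\<rangle> x\<^sub>\<alpha>\<close> converge to some \<open>y\<close>;
  Bessel for a single index also shows that \<open>\<langle>\<cdot>, x\<^sub>\<beta>\<rangle>\<close> is continuous, so it may be applied termwise.
  Hence \<open>x - y\<close> is orthogonal to every \<open>x\<^sub>\<beta>\<close>, and since \<open>\<langle>u, u\<rangle>\<close> is real it could be
  normalized and added to the system if it were nonzero, contradicting maximality.
\<close>

section \<open>Octonion arithmetic and real parts\<close>

lemma oct_mult_one_right: "p * 1 = (p::octonion)"
  by transfer (simp add: quat_cnj_def quat_mult_def prod_eq_iff)

lemma oct_mult_zero_right: "p * 0 = (0::octonion)"
  by transfer (simp add: quat_cnj_def quat_mult_def prod_eq_iff)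

lemma oct_cnj_zero: "oct_cnj 0 = 0"
  by transfer (simp add: quat_cnj_def prod_eq_iff)

lemma oct_one_neq_zero: "(1::octonion) \<noteq> 0"
  by transfer (simp add: prod_eq_iff)

lemma oct_Re_one: "oct_Re 1 = 1"
  by transfer simp

lemma oct_Re_cnj: "oct_Re (oct_cnj p) = oct_Re p"
  by transfer (simp add: quat_cnj_def)

lemma linear_oct_Re: "linear oct_Re"
  by (rule linearI; transfer; simp)

lemma oct_Re_mult_cnj: "oct_Re (p * oct_cnj p) = (norm p)\<^sup>2"
  by (simp add: oct_mult_cnj linear_scale[OF linear_oct_Re] oct_Re_one)

text \<open>Pythagoras makes the squared distance of nested partial sums of \<open>f\<close> a
  difference of partial sums of \<open>g\<close>, so the Cauchy property passes from
  \<open>g\<close> to \<open>f\<close>.\<close>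

lemma summable_on_of_norm_sum_power2:
  fixes f :: "'i \<Rightarrow> 'a::banach" and g :: "'i \<Rightarrow> real"
  assumes g: "g summable_on I"
    and norm_sum: "\<And>F. finite F \<Longrightarrow> F \<subseteq> I \<Longrightarrow> (norm (sum f F))\<^sup>2 = sum g F"
  shows "f summable_on I"
proof -
  obtain L where L: "(sum g \<longlongrightarrow> L) (finite_subsets_at_top I)"
    using g by (auto simp: summable_on_def has_sum_def)
  have "\<exists>P. eventually P (finite_subsets_at_top I) \<and>
      (\<forall>F F'. P F \<and> P F' \<longrightarrow> dist (sum f F) (sum f F') < r)" if "r > 0" for r
  proof -
    \<comment> \<open>Two partial sums of \<open>g\<close> this close to \<open>L\<close> differ by
      less than \<open>(r / 2)\<^sup>2\<close>. The corresponding sums of \<open>f\<close> are then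
      within \<open>r / 2\<close> of \<open>sum f K\<close>, hence within \<open>r\<close> of each
      other.\<close>
    have "r\<^sup>2 / 8 > 0"
      using that by simp
    with L have "\<forall>\<^sub>F F in finite_subsets_at_top I. dist (sum g F) L < r\<^sup>2 / 8"
      by (rule tendstoD)
    then obtain K where K: "finite K" "K \<subseteq> I"
      and Kg: "\<And>F. finite F \<Longrightarrow> K \<subseteq> F \<Longrightarrow> F \<subseteq> I \<Longrightarrow> dist (sum g F) L < r\<^sup>2 / 8"
      unfolding eventually_finite_subsets_at_top by auto
    have near: "dist (sum f F) (sum f K) < r / 2" if F: "finite F" "K \<subseteq> F" "F \<subseteq> I" for F
    proof (rule power2_less_imp_less)
      have "(dist (sum f F) (sum f K))\<^sup>2 = (norm (sum f (F - K)))\<^sup>2"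
        using F by (simp add: dist_norm sum_diff)
      also have "\<dots> = sum g F - sum g K"
        using F by (subst norm_sum) (auto simp: sum_diff)
      also have "\<dots> < (r / 2)\<^sup>2"
        using Kg[OF F] Kg[OF K(1) order_refl K(2)]
        unfolding dist_real_def abs_diff_less_iff by (simp add: power_divide)
      finally show "(dist (sum f F) (sum f K))\<^sup>2 < (r / 2)\<^sup>2" .
    qed (use that \<open>r > 0\<close> in simp)
    let ?P = "\<lambda>F. finite F \<and> K \<subseteq> F \<and> F \<subseteq> I"
    have "eventually ?P (finite_subsets_at_top I)"
      unfolding eventually_finite_subsets_at_top using K by (intro exI[of _ K]) simp
    moreover have "dist (sum f F) (sum f F') < r" if "?P F \<and> ?P F'" for F F'
      using that by (blast intro: dist_triangle_half_l[OF near near])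
    ultimately show ?thesis
      by blast
  qed
  \<comment> \<open>The index set may be uncountable, so completeness is applied to the filter of
    finite partial sums instead of a sequence.\<close>
  then have "cauchy_filter (filtermap (sum f) (finite_subsets_at_top I))"
    by (simp add: cauchy_filter_metric_filtermap)
  moreover have "complete (UNIV :: 'a set)"
    by (meson Cauchy_convergent UNIV_I complete_def convergent_def)
  ultimately obtain s where "(sum f \<longlongrightarrow> s) (finite_subsets_at_top I)"
    using complete_uniform[where S = UNIV] by (force simp: filterlim_def)
  then show ?thesis
    by (auto simp: summable_on_def has_sum_def)
qed

section \<open>Real parts, norms and maximality in a Hilbert module\<close>

context octonion_hilbert_module
begin

lemma ip_sum_left: "ip (\<Sum>i\<in>F. f i) v = (\<Sum>i\<in>F. ip (f i) v)"
  by (rule linear_sum) (use bilinear_ip in \<open>simp add: bilinear_def\<close>)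

text \<open>This substitute for octonion-linearity holds for all vectors and suffices for norm
  computations, because squared norms are real parts.\<close>

lemma oct_Re_ip_act: "oct_Re (ip (act p u) v) = oct_Re (p * ip u v)"
  using Re_ip_act[of p u v] by (simp add: linear_diff[OF linear_oct_Re])

lemma oct_Re_ip_commute: "oct_Re (ip u v) = oct_Re (ip v u)"
  by (metis ip_cnj oct_Re_cnj)

lemma ip_self: "ip u u = (norm u)\<^sup>2 *\<^sub>R 1"
proof -
  obtain r where "r \<ge> 0" "ip u u = r *\<^sub>R 1"
    using ip_self_nonneg by blast
  then show ?thesis
    by (simp add: norm_eq linear_scale[OF linear_oct_Re] oct_Re_one)
qed

lemma norm_power2: "(norm u)\<^sup>2 = oct_Re (ip u u)"
  by (simp add: ip_self linear_scale[OF linear_oct_Re] oct_Re_one)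

lemma norm_diff_power2:
  "(norm (u - v))\<^sup>2 = (norm u)\<^sup>2 - 2 * oct_Re (ip v u) + (norm v)\<^sup>2"
  using oct_Re_ip_commute[of u v]
  by (simp add: norm_power2 bilinear_lsub[OF bilinear_ip] bilinear_rsub[OF bilinear_ip]
      linear_diff[OF linear_oct_Re])

lemma orthonormal_basis_complete:
  assumes basis: "orthonormal_basis ip e I"
    and orth: "\<And>i. i \<in> I \<Longrightarrow> ip z (e i) = 0"
  shows "z = 0"
proof (rule ccontr)
  assume "z \<noteq> 0"
  define w where "w = z /\<^sub>R norm z"
  have w_unit: "ip w w = 1"
    using \<open>z \<noteq> 0\<close> by (simp add: ip_self w_def)
  have w_left: "ip w (e i) = 0" if "i \<in> I" for i
    using orth[OF that] by (simp add: w_def bilinear_lmul[OF bilinear_ip])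
  have w_right: "ip (e i) w = 0" if "i \<in> I" for i
    using w_left[OF that] by (metis ip_cnj oct_cnj_zero)
  have on: "orthonormal_system ip e I"
    using basis by (simp add: orthonormal_basis_def)
  \<comment> \<open>The enlarged system is a set indexed by itself, so the deltas between indices
    must become deltas between vectors.\<close>
  have e_inj: "i = j" if "i \<in> I" "j \<in> I" "e i = e j" for i j
    using on that oct_one_neq_zero unfolding orthonormal_system_def by metis
  have "w \<notin> e ` I"
    using w_unit w_left oct_one_neq_zero by auto
  then have "e ` I \<subset> insert w (e ` I)"
    by blast
  moreover have "orthonormal_system ip (\<lambda>t. t) (insert w (e ` I))"
    using on w_unit w_left w_right \<open>w \<notin> e ` I\<close>
    unfolding orthonormal_system_def by (auto dest: e_inj)
  ultimately show False
    using basis unfolding orthonormal_basis_def by blast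
qed

end

section \<open>Expansions in a weak associative basis\<close>

locale weak_associative_orthonormal_basis = octonion_hilbert_module act ip
  for act :: "octonion \<Rightarrow> 'a::banach \<Rightarrow> 'a" and ip :: "'a \<Rightarrow> 'a \<Rightarrow> octonion" +
  fixes e :: "'i \<Rightarrow> 'a" and I :: "'i set"
  assumes weak_associative: "weak_associative_basis act ip e I"
begin

lemma ip_act_basis:
  assumes "i \<in> I" "j \<in> I"
  shows "ip (act p (e i)) (e j) = (if i = j then p else 0)"
proof -
  have "ip (act p (e i)) (e j) = p * ip (e i) (e j)"
    using weak_associative assms
    by (simp add: weak_associative_basis_def second_associator_def)
  also have "ip (e i) (e j) = (if i = j then 1 else 0)"
    using weak_associative assms
    by (simp add: weak_associative_basis_def orthonormal_basis_def orthonormal_system_def)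
  finally show ?thesis
    by (simp add: oct_mult_one_right oct_mult_zero_right)
qed

lemma ip_sum_basis:
  assumes "finite F" "F \<subseteq> I" "j \<in> F"
  shows "ip (\<Sum>i\<in>F. act (p i) (e i)) (e j) = p j"
proof -
  have "ip (\<Sum>i\<in>F. act (p i) (e i)) (e j) = (\<Sum>i\<in>F. if i = j then p i else 0)"
    unfolding ip_sum_left using assms by (intro sum.cong) (auto simp: ip_act_basis subset_iff)
  then show ?thesis
    using assms by simp
qed

text \<open>Since \<open>v\<close> is arbitrary, weak associativity does not apply; under the real
  part each term becomes \<open>p i * oct_cnj (p i)\<close>. Taking \<open>v\<close> to be the sum
  itself gives Pythagoras, and \<open>v = x\<close> gives the cross term in Bessel.\<close>

lemma oct_Re_ip_sum_basis:
  assumes "\<And>i. i \<in> F \<Longrightarrow> ip v (e i) = p i"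
  shows "oct_Re (ip (\<Sum>i\<in>F. act (p i) (e i)) v) = (\<Sum>i\<in>F. (norm (p i))\<^sup>2)"
proof -
  have "oct_Re (ip (act (p i) (e i)) v) = (norm (p i))\<^sup>2" if "i \<in> F" for i
    using assms[OF that] ip_cnj[of "e i" v] by (simp add: oct_Re_ip_act oct_Re_mult_cnj)
  then show ?thesis
    by (simp add: ip_sum_left linear_sum[OF linear_oct_Re])
qed

lemma norm_sum_basis:
  assumes "finite F" "F \<subseteq> I"
  shows "(norm (\<Sum>i\<in>F. act (p i) (e i)))\<^sup>2 = (\<Sum>i\<in>F. (norm (p i))\<^sup>2)"
  unfolding norm_power2 using assms by (intro oct_Re_ip_sum_basis ip_sum_basis)

lemma norm_act_basis: "i \<in> I \<Longrightarrow> norm (act p (e i)) = norm p"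
  using norm_sum_basis[of "{i}" "\<lambda>_. p"] by simp

lemma bessel:
  assumes "finite F" "F \<subseteq> I"
  shows "(\<Sum>i\<in>F. (norm (ip x (e i)))\<^sup>2) \<le> (norm x)\<^sup>2"
proof -
  let ?s = "\<Sum>i\<in>F. act (ip x (e i)) (e i)"
  have "0 \<le> (norm (x - ?s))\<^sup>2"
    by simp
  \<comment> \<open>The cross term and the squared norm of \<open>?s\<close> are the same sum,
    entering with factors -2 and 1.\<close>
  also have "\<dots> = (norm x)\<^sup>2 - (\<Sum>i\<in>F. (norm (ip x (e i)))\<^sup>2)"
    using oct_Re_ip_sum_basis[of F x "\<lambda>i. ip x (e i)"] norm_sum_basis[OF assms]
    by (simp add: norm_diff_power2)
  finally show ?thesis
    by simp
qed

lemma bounded_linear_ip_basis: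
  assumes "j \<in> I"
  shows "bounded_linear (\<lambda>u. ip u (e j))"
proof (rule bounded_linear_intro[where K = 1])
  show "norm (ip u (e j)) \<le> norm u * 1" for u
    by (rule power2_le_imp_le) (use bessel[of "{j}" u] assms in simp_all)
qed (simp_all add: bilinear_ladd[OF bilinear_ip] bilinear_lmul[OF bilinear_ip])

text \<open>Applying the continuous map \<open>\<lambda>u. ip u (e j)\<close> termwise leaves only
  the term at \<open>j\<close>. This yields uniqueness and also identifies the coefficients of the
  limit in \<open>basis_expansion\<close>.\<close>

lemma basis_coefficient:
  assumes "((\<lambda>i. act (p i) (e i)) has_sum y) I" and "j \<in> I"
  shows "p j = ip y (e j)"
proof (rule has_sum_unique)
  show "((\<lambda>i. ip (act (p i) (e i)) (e j)) has_sum ip y (e j)) I"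
    using bounded_linear_ip_basis[OF \<open>j \<in> I\<close>] assms(1) by (rule has_sum_bounded_linear)
  show "((\<lambda>i. ip (act (p i) (e i)) (e j)) has_sum p j) I"
    by (rule has_sum_finite_neutralI[of "{j}"]) (use assms(2) in \<open>auto simp: ip_act_basis\<close>)
qed

lemma summable_coefficients: "(\<lambda>i. (norm (ip x (e i)))\<^sup>2) summable_on I"
  by (rule nonneg_bdd_above_summable_on) (auto intro!: bdd_aboveI2 bessel)

lemma basis_expansion: "((\<lambda>i. act (ip x (e i)) (e i)) has_sum x) I"
proof -
  have "(\<lambda>i. act (ip x (e i)) (e i)) summable_on I"
    by (rule summable_on_of_norm_sum_power2[OF summable_coefficients norm_sum_basis])
  then obtain y where y: "((\<lambda>i. act (ip x (e i)) (e i)) has_sum y) I"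
    by (auto simp: summable_on_def)
  have "x - y = 0"
  proof (rule orthonormal_basis_complete)
    show "orthonormal_basis ip e I"
      using weak_associative by (simp add: weak_associative_basis_def)
    show "ip (x - y) (e j) = 0" if "j \<in> I" for j
      using basis_coefficient[of "\<lambda>i. ip x (e i)", OF y that] by (simp add: bilinear_lsub[OF bilinear_ip])
  qed
  with y show ?thesis
    by simp
qed

text \<open>The squared norm is continuous, and Pythagoras evaluates it on the partial sums of the
  expansion.\<close>

lemma parseval: "((\<lambda>i. (norm (ip x (e i)))\<^sup>2) has_sum (norm x)\<^sup>2) I"
proof -
  have "((\<lambda>F. (norm (\<Sum>i\<in>F. act (ip x (e i)) (e i)))\<^sup>2) \<longlongrightarrow> (norm x)\<^sup>2) (finite_subsets_at_top I)"
    using basis_expansion[of x] unfolding has_sum_def by (intro tendsto_intros)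
  moreover have "\<forall>\<^sub>F F in finite_subsets_at_top I.
      (norm (\<Sum>i\<in>F. act (ip x (e i)) (e i)))\<^sup>2 = (\<Sum>i\<in>F. (norm (ip x (e i)))\<^sup>2)"
    by (rule eventually_finite_subsets_at_top_weakI) (rule norm_sum_basis)
  ultimately show ?thesis
    unfolding has_sum_def by (rule Lim_transform_eventually)
qed

lemma countable_coefficients: "countable {i\<in>I. ip x (e i) \<noteq> 0}"
  using summable_countable_real[OF summable_coefficients] by simp

end

theorem theorem4p9:
  fixes act :: "octonion \<Rightarrow> 'a::banach \<Rightarrow> 'a"
    and ip :: "'a \<Rightarrow> 'a \<Rightarrow> octonion"
    and e :: "'i \<Rightarrow> 'a" and I :: "'i set"
    and x :: 'a
  assumes "octonion_hilbert_module act ip"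
    and "weak_associative_basis act ip e I"
  shows "has_countable_sum (\<lambda>i. act (ip x (e i)) (e i)) x I \<and>
    (\<forall>p :: 'i \<Rightarrow> octonion. has_countable_sum (\<lambda>i. act (p i) (e i)) x I \<longrightarrow>
       (\<forall>i\<in>I. p i = ip x (e i))) \<and>
    has_countable_sum (\<lambda>i. (norm (ip x (e i)))\<^sup>2) ((norm x)\<^sup>2) I"
proof -
  interpret weak_associative_orthonormal_basis act ip e I
    using assms
    by (simp add: weak_associative_orthonormal_basis_def weak_associative_orthonormal_basis_axioms_def)
  \<comment> \<open>A term has the norm of its coefficient, so both vanish together and countability
    carries over from coefficients to terms.\<close>
  have "{i\<in>I. act (ip x (e i)) (e i) \<noteq> 0} = {i\<in>I. ip x (e i) \<noteq> 0}"
  proof -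
    have "act (ip x (e i)) (e i) = 0 \<longleftrightarrow> ip x (e i) = 0" if "i \<in> I" for i
      using norm_act_basis[OF that, of "ip x (e i)"] by (metis norm_eq_zero)
    then show ?thesis
      by blast
  qed
  then have "has_countable_sum (\<lambda>i. act (ip x (e i)) (e i)) x I"
    using basis_expansion countable_coefficients by (simp add: has_countable_sum_def)
  moreover have "has_countable_sum (\<lambda>i. (norm (ip x (e i)))\<^sup>2) ((norm x)\<^sup>2) I"
    using parseval countable_coefficients by (simp add: has_countable_sum_def)
  moreover have "\<forall>p. has_countable_sum (\<lambda>i. act (p i) (e i)) x I \<longrightarrow>
      (\<forall>i\<in>I. p i = ip x (e i))"
  proof (intro allI impI ballI)
    fix p i
    assume "has_countable_sum (\<lambda>i. act (p i) (e i)) x I" and "i \<in> I"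
    then show "p i = ip x (e i)"
      using basis_coefficient[of p x i] by (simp only: has_countable_sum_def)
  qed
  ultimately show ?thesis
    by (intro conjI)
qed

end
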